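(* Let $\alpha>0$ and let $\mathfrak{g}=\mathfrak{g}_{4.9}^{\alpha}$ be the four-dimensional real Lie algebra with basis $\mathcal{B}=\{e_1,e_2,e_3,e_4\}$ whose nonzero Lie brackets (up to skew-symmetry) are $[e_1,e_4]=2\alpha e_1$, $[e_2,e_4]=\alpha e_2-e_3$, $[e_3,e_4]=e_2+\alpha e_3$, $[e_2,e_3]=e_1$. Let $\langle\cdot,\cdot\rangle$ be a pseudo-Riemannian inner product on $\mathfrak{g}$ and let $(R_{ij})$ be the matrix of its Ricci operator $\operatorname{Ric}$ in the basis $\mathcal{B}$. If $$R_{i1}=0\ (i=2,3,4),\quad R_{42}=R_{43}=0,\quad R_{34}=-\alpha R_{12}-R_{13},\quad R_{32}=-R_{23},$$ $$R_{22}=R_{33},\quad R_{24}=-R_{12}+\alpha R_{13},\quad R_{44}=R_{22}+R_{33}-R_{11},$$ then $\langle\cdot,\cdot\rangle$ is an algebraic Ricci soliton. In this case, $\operatorname{Ric}=\eta I_4+D$ where $\eta=R_{44}=R_{22}+R_{33}-R_{11}$ and $$D=\begin{bmatrix}R_{11}-R_{44}&R_{12}&R_{13}&R_{14}\\0&R_{22}-R_{44}&R_{23}&-R_{12}+\alpha R_{13}\\0&-R_{23}&R_{22}-R_{44}&-\alpha R_{12}-R_{13}\\0&0&0&0\end{bmatrix}$$ is (the matrix in the basis $\mathcal{B}$ of) a derivation of $\mathfrak{g}$.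
   Context: A pseudo-Riemannian inner product on a real Lie algebra $\mathfrak{g}$ is a nondegenerate symmetric bilinear form $\langle\cdot,\cdot\rangle$ on $\mathfrak{g}$ (of some signature $(r,s)$). Its Levi-Civita connection $\nabla$ is defined by $2\langle\nabla_uv,w\rangle=\langle[u,v],w\rangle+\langle[w,u],v\rangle+\langle[w,v],u\rangle$; its curvature is $R_{uv}=\nabla_{[u,v]}-[\nabla_u,\nabla_v]$; its Ricci curvature $\operatorname{ric}(u,v)$ is the trace of $w\mapsto R_{uw}v$; its Ricci operator $\operatorname{Ric}$ is the endomorphism of $\mathfrak{g}$ with $\langle\operatorname{Ric}(u),v\rangle=\operatorname{ric}(u,v)$. The matrix $(R_{ij})$ of $\operatorname{Ric}$ in a basis $\{e_i\}$ is given by $\operatorname{Ric}(e_j)=\sum_iR_{ij}e_i$ (the same column convention is used for $D$). A derivation is a linear map $D:\mathfrak{g}\to\mathfrak{g}$ with $D[x,y]=[D(x),y]+[x,D(y)]$ for all $x,y$. The inner product is an algebraic Ricci soliton if $\operatorname{Ric}=\eta\,\mathrm{Id}_{\mathfrak{g}}+D$ for some $\eta\in\mathbb{R}$ and some derivation $D$ of $\mathfrak{g}$. *)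

theory Defs
  imports "HOL-Analysis.Analysis"
begin

section \<open>Pseudo-Riemannian inner products on Lie algebras with underlying space \<open>real ^ 'n\<close>\<close>

definition lie_bracket :: "('a::real_vector \<Rightarrow> 'a \<Rightarrow> 'a) \<Rightarrow> bool" where
  "lie_bracket br \<longleftrightarrow>
     bilinear br \<and> (\<forall>x. br x x = 0) \<and>
     (\<forall>x y z. br x (br y z) + br y (br z x) + br z (br x y) = 0)"

definition pseudo_riemannian :: "('a::real_vector \<Rightarrow> 'a \<Rightarrow> real) \<Rightarrow> bool" where
  "pseudo_riemannian g \<longleftrightarrow>
     bilinear g \<and> (\<forall>x y. g x y = g y x) \<and> (\<forall>x. (\<forall>y. g x y = 0) \<longrightarrow> x = 0)"

definition derivation :: "('a::real_vector \<Rightarrow> 'a \<Rightarrow> 'a) \<Rightarrow> ('a \<Rightarrow> 'a) \<Rightarrow> bool" where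
  "derivation br D \<longleftrightarrow> linear D \<and> (\<forall>x y. D (br x y) = br (D x) y + br x (D y))"

text \<open>The vectors picked out by \<^const>\<open>The\<close> below exist and are unique: see
  \<open>ex1_represents_linear_form\<close>, \<open>levi_civita_koszul\<close> and \<open>ricci_operator_represents\<close>.\<close>

definition levi_civita ::
    "('a::real_vector \<Rightarrow> 'a \<Rightarrow> 'a) \<Rightarrow> ('a \<Rightarrow> 'a \<Rightarrow> real) \<Rightarrow> 'a \<Rightarrow> 'a \<Rightarrow> 'a" where
  "levi_civita br g u v =
     (THE x. \<forall>w. 2 * g x w = g (br u v) w + g (br w u) v + g (br w v) u)"

text \<open>The sign convention is \<open>R\<^sub>u\<^sub>v = \<nabla>\<^bsub>[u,v]\<^esub> - [\<nabla>\<^sub>u, \<nabla>\<^sub>v]\<close>.\<close>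

definition curvature ::
    "('a::real_vector \<Rightarrow> 'a \<Rightarrow> 'a) \<Rightarrow> ('a \<Rightarrow> 'a \<Rightarrow> real) \<Rightarrow> 'a \<Rightarrow> 'a \<Rightarrow> 'a \<Rightarrow> 'a" where
  "curvature br g u v w =
     levi_civita br g (br u v) w
     - (levi_civita br g u (levi_civita br g v w) - levi_civita br g v (levi_civita br g u w))"

definition ricci ::
    "(real^'n \<Rightarrow> real^'n \<Rightarrow> real^'n) \<Rightarrow> (real^'n \<Rightarrow> real^'n \<Rightarrow> real)
      \<Rightarrow> real^'n \<Rightarrow> real^'n \<Rightarrow> real" where
  "ricci br g u v = trace (matrix (\<lambda>w. curvature br g u w v))"

definition ricci_operator ::
    "(real^'n \<Rightarrow> real^'n \<Rightarrow> real^'n) \<Rightarrow> (real^'n \<Rightarrow> real^'n \<Rightarrow> real)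
      \<Rightarrow> real^'n \<Rightarrow> real^'n" where
  "ricci_operator br g u = (THE x. \<forall>v. g x v = ricci br g u v)"

definition algebraic_ricci_soliton ::
    "(real^'n \<Rightarrow> real^'n \<Rightarrow> real^'n) \<Rightarrow> (real^'n \<Rightarrow> real^'n \<Rightarrow> real) \<Rightarrow> bool" where
  "algebraic_ricci_soliton br g \<longleftrightarrow>
     (\<exists>\<eta> D. derivation br D \<and> ricci_operator br g = (\<lambda>x. \<eta> *\<^sub>R x + D x))"


subsection \<open>Well-definedness\<close>

lemma ex1_represents_linear_form:
  fixes g :: "real^'n \<Rightarrow> real^'n \<Rightarrow> real"
  assumes g: "pseudo_riemannian g" and \<phi>: "linear \<phi>"
  shows "\<exists>!x. \<forall>w. g x w = \<phi> w"
proof -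
  have bil: "bilinear g" and nondeg: "\<And>x. (\<forall>y. g x y = 0) \<Longrightarrow> x = 0"
    using g by (auto simp: pseudo_riemannian_def)
  have lin: "linear (g x)" for x
    using bil by (simp add: bilinear_def)
  define F :: "real^'n \<Rightarrow> real^'n" where "F = (\<lambda>x. \<chi> i. g x (axis i 1))"
  have F: "linear F"
    unfolding F_def
    by (rule linearI) (simp_all add: vec_eq_iff bilinear_ladd[OF bil] bilinear_lmul[OF bil])
  have ext: "(\<forall>w. g x w = \<psi> w) \<longleftrightarrow> F x = (\<chi> i. \<psi> (axis i 1))" if \<psi>: "linear \<psi>" for x \<psi>
  proof
    assume eq: "F x = (\<chi> i. \<psi> (axis i 1))"
    have "g x = \<psi>"
    proof (rule linear_eq_stdbasis[OF lin \<psi>])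
      fix b :: "real^'n" assume "b \<in> Basis"
      then obtain i where "b = axis i 1" by (auto simp: Basis_vec_def)
      then show "g x b = \<psi> b"
        using fun_cong[OF arg_cong[OF eq, of vec_nth], of i] by (simp add: F_def)
    qed
    then show "\<forall>w. g x w = \<psi> w" by simp
  qed (simp add: F_def)
  have zero: "linear (\<lambda>_::real^'n. 0::real)" by (rule linear_zero)
  have "inj F"
    unfolding linear_injective_0[OF F]
    using ext[OF zero] nondeg by (auto simp: vec_eq_iff)
  moreover have "surj F"
    using F \<open>inj F\<close> by (rule eucl.linear_inj_imp_surj)
  ultimately have "\<exists>!x. F x = (\<chi> i. \<phi> (axis i 1))"
    by (metis bij_def bij_pointE)
  then show ?thesis
    by (simp add: ext[OF \<phi>])
qed

lemma levi_civita_koszul: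
  fixes br :: "real^'n \<Rightarrow> real^'n \<Rightarrow> real^'n"
  assumes g: "pseudo_riemannian g" and br: "bilinear br"
  shows "2 * g (levi_civita br g u v) w = g (br u v) w + g (br w u) v + g (br w v) u"
proof -
  have bil: "bilinear g"
    using g by (simp add: pseudo_riemannian_def)
  have "linear (\<lambda>w. (g (br u v) w + g (br w u) v + g (br w v) u) / 2)"
    by (rule linearI)
       (simp_all add: bilinear_ladd[OF bil] bilinear_lmul[OF bil] bilinear_radd[OF bil]
          bilinear_rmul[OF bil] bilinear_ladd[OF br] bilinear_lmul[OF br] field_simps)
  from ex1_represents_linear_form[OF g this]
  have "\<exists>!x. \<forall>w. 2 * g x w = g (br u v) w + g (br w u) v + g (br w v) u"
    by (simp add: field_simps)
  from theI'[OF this] show ?thesis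
    by (simp add: levi_civita_def)
qed

lemma pseudo_riemannian_eqI:
  assumes "pseudo_riemannian g" and "\<And>w. g x w = g y w"
  shows "x = y"
proof -
  have "bilinear g" and "(\<forall>w. g (x - y) w = 0) \<Longrightarrow> x - y = 0"
    using assms(1) unfolding pseudo_riemannian_def by blast+
  then show ?thesis
    using assms(2) by (simp add: bilinear_lsub)
qed

lemma bilinear_levi_civita:
  fixes br :: "real^'n \<Rightarrow> real^'n \<Rightarrow> real^'n"
  assumes g: "pseudo_riemannian g" and br: "bilinear br"
  shows "bilinear (levi_civita br g)"
proof -
  have bil: "bilinear g"
    using g by (simp add: pseudo_riemannian_def)
  note K = levi_civita_koszul[OF g br]
  note simps = bilinear_ladd[OF bil] bilinear_lmul[OF bil] bilinear_radd[OF bil]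
    bilinear_rmul[OF bil] bilinear_ladd[OF br] bilinear_lmul[OF br]
    bilinear_radd[OF br] bilinear_rmul[OF br]
  have half: "x = y" if "\<And>w. 2 * g x w = 2 * g y w" for x y
    using that by (intro pseudo_riemannian_eqI[OF g]) simp
  have scale: "2 * g (c *\<^sub>R x) w = c * (2 * g x w)" for c x w
    by (simp add: simps)
  have add: "2 * g (x + y) w = 2 * g x w + 2 * g y w" for x y w
    by (simp add: simps)
  show ?thesis
    unfolding bilinear_def
    by (intro conjI allI linearI half; simp only: K scale add; simp add: simps algebra_simps)
qed

lemma ricci_operator_represents:
  fixes br :: "real^'n \<Rightarrow> real^'n \<Rightarrow> real^'n"
  assumes g: "pseudo_riemannian g" and br: "bilinear br"
  shows "g (ricci_operator br g u) v = ricci br g u v"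
proof -
  note bil = bilinear_levi_civita[OF g br]
  have "linear (ricci br g u)"
    by (rule linearI)
       (simp_all add: ricci_def trace_def matrix_def curvature_def bilinear_radd[OF bil]
          bilinear_rmul[OF bil] sum.distrib sum_distrib_left sum_subtractf algebra_simps)
  from theI'[OF ex1_represents_linear_form[OF g this]] show ?thesis
    by (simp add: ricci_operator_def)
qed


section \<open>The Lie algebra \<open>\<gg>\<^sub>4\<^sub>.\<^sub>9\<^sup>\<alpha>\<close>\<close>

lemma vector_4 [simp]:
  "(vector [a, b, c, d] :: 'a::zero^4) $ 1 = a"
  "(vector [a, b, c, d] :: 'a::zero^4) $ 2 = b"
  "(vector [a, b, c, d] :: 'a::zero^4) $ 3 = c"
  "(vector [a, b, c, d] :: 'a::zero^4) $ 4 = d"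
  unfolding vector_def by auto

text \<open>The basis vector \<open>e\<^sub>i\<close> is \<^term>\<open>axis i 1 :: real^4\<close>. The formula is the bilinear,
  alternating extension of the bracket relations listed in \<open>g49_bracket_basis\<close>.\<close>

definition g49_bracket :: "real \<Rightarrow> real^4 \<Rightarrow> real^4 \<Rightarrow> real^4" where
  "g49_bracket \<alpha> x y =
     (let p = (\<lambda>i j. x$i * y$j - x$j * y$i) in
      vector [2 * \<alpha> * p 1 4 + p 2 3,
              \<alpha> * p 2 4 + p 3 4,
              - p 2 4 + \<alpha> * p 3 4,
              0])"

lemma g49_bracket_basis:
  fixes \<alpha> :: real
  defines "e \<equiv> (\<lambda>i::4. axis i 1 :: real^4)"
  shows "g49_bracket \<alpha> (e 1) (e 4) = (2 * \<alpha>) *\<^sub>R e 1"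
    and "g49_bracket \<alpha> (e 2) (e 4) = \<alpha> *\<^sub>R e 2 - e 3"
    and "g49_bracket \<alpha> (e 3) (e 4) = e 2 + \<alpha> *\<^sub>R e 3"
    and "g49_bracket \<alpha> (e 2) (e 3) = e 1"
    and "g49_bracket \<alpha> (e 1) (e 2) = 0"
    and "g49_bracket \<alpha> (e 1) (e 3) = 0"
  by (simp_all add: e_def g49_bracket_def Let_def vec_eq_iff forall_4 axis_def)

lemma lie_bracket_g49: "lie_bracket (g49_bracket \<alpha>)"
  unfolding lie_bracket_def bilinear_def
  by (intro conjI allI linearI)
     (simp_all add: g49_bracket_def Let_def vec_eq_iff forall_4 algebra_simps)

end

theory Submission
  imports Defs
begin

text \<open>The Ricci operator equals R44 Id + D as soon as it is multiplication by its matrix R,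
  because the hypotheses say entry by entry that R - R44 I is D. So everything rests on D being a
  derivation. On [e2,e3] = e1, Leibniz says that the e1-weight is the sum of the e2- and e3-weights,
  which is R44 = R22 + R33 - R11. On [e2,e4] and [e3,e4], the e1-components force the values of R34
  and R24, and the (e2,e3)-components hold because a scalar plus a skew 2x2 block commutes with the
  action of e4.\<close>

text \<open>\<open>ricci_operator\<close> picks a vector separately for each argument, so linearity
  has to be derived: \<open>ricci\<close> is linear in its first slot, and nondegeneracy of g
  transfers this to the representing vectors.\<close>

lemma linear_ricci_operator:
  fixes br :: "real^'n \<Rightarrow> real^'n \<Rightarrow> real^'n"
  assumes g: "pseudo_riemannian g" and br: "bilinear br"
  shows "linear (ricci_operator br g)"
proof -
  have bil: "bilinear g"
    using g by (simp add: pseudo_riemannian_def)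
  note lc = bilinear_levi_civita[OF g br]
  note rep = ricci_operator_represents[OF g br]
  note simps = bilinear_ladd[OF lc] bilinear_lmul[OF lc] bilinear_radd[OF lc]
    bilinear_rmul[OF lc] bilinear_ladd[OF br] bilinear_lmul[OF br]
  have "ricci br g (u + v) w = ricci br g u w + ricci br g v w" for u v w
    by (simp add: ricci_def trace_def matrix_def curvature_def simps sum.distrib
        sum_subtractf algebra_simps)
  moreover have "ricci br g (c *\<^sub>R u) w = c * ricci br g u w" for c u w
    by (simp add: ricci_def trace_def matrix_def curvature_def simps sum_distrib_left
        sum.distrib sum_subtractf algebra_simps)
  ultimately show ?thesis
    by (intro linearI pseudo_riemannian_eqI[OF g])
       (simp_all add: rep bilinear_ladd[OF bil] bilinear_lmul[OF bil])
qed

theorem theorem4p11: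
  fixes \<alpha> :: real
    and g :: "real^4 \<Rightarrow> real^4 \<Rightarrow> real"
    and R :: "real^4^4"
  assumes "\<alpha> > 0"
    and "pseudo_riemannian g"
    and "R = matrix (ricci_operator (g49_bracket \<alpha>) g)"
    and "R$2$1 = 0" and "R$3$1 = 0" and "R$4$1 = 0"
    and "R$4$2 = 0" and "R$4$3 = 0"
    and "R$3$4 = - \<alpha> * R$1$2 - R$1$3"
    and "R$3$2 = - R$2$3"
    and "R$2$2 = R$3$3"
    and "R$2$4 = - R$1$2 + \<alpha> * R$1$3"
    and "R$4$4 = R$2$2 + R$3$3 - R$1$1"
  shows "algebraic_ricci_soliton (g49_bracket \<alpha>) g \<and>
    (let \<eta> = R$4$4;
         D = vector [vector [R$1$1 - R$4$4, R$1$2,           R$1$3,           R$1$4],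
                     vector [0,             R$2$2 - R$4$4,   R$2$3,           - R$1$2 + \<alpha> * R$1$3],
                     vector [0,             - R$2$3,         R$2$2 - R$4$4,   - \<alpha> * R$1$2 - R$1$3],
                     vector [0,             0,               0,               0]] :: real^4^4
     in \<eta> = R$2$2 + R$3$3 - R$1$1 \<and>
        derivation (g49_bracket \<alpha>) ((*v) D) \<and>
        ricci_operator (g49_bracket \<alpha>) g = (\<lambda>x. \<eta> *\<^sub>R x + D *v x))"
proof -
  define D :: "real^4^4" where
    "D = vector [vector [R$1$1 - R$4$4, R$1$2, R$1$3, R$1$4],
                 vector [0, R$2$2 - R$4$4, R$2$3, - R$1$2 + \<alpha> * R$1$3],
                 vector [0, - R$2$3, R$2$2 - R$4$4, - \<alpha> * R$1$2 - R$1$3],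
                 vector [0, 0, 0, 0]]"
  \<comment> \<open>With R44 and R22 eliminated, the diagonal of D satisfies R11 - R44 = 2 (R22 -
    R44), and Leibniz becomes a polynomial identity in the coordinates.\<close>
  have der: "derivation (g49_bracket \<alpha>) ((*v) D)"
    unfolding derivation_def
    by (simp add: D_def assms(13) g49_bracket_def Let_def vec_eq_iff forall_4
        matrix_vector_mult_def sum_4 algebra_simps \<open>R$2$2 = R$3$3\<close>)
  have "bilinear (g49_bracket \<alpha>)"
    using lie_bracket_g49 by (simp add: lie_bracket_def)
  then have "linear (ricci_operator (g49_bracket \<alpha>) g)"
    by (rule linear_ricci_operator[OF assms(2)])
  \<comment> \<open>Linearity is what allows the operator to be recovered from its values on the
    basis.\<close>
  then have "ricci_operator (g49_bracket \<alpha>) g x = R *v x" for x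
    using assms(3) by (simp add: matrix_works)
  \<comment> \<open>R44 stays symbolic here: it cancels on the diagonal in the first three rows, and
    the zero last row of D leaves R44 in the fourth.\<close>
  moreover have "R *v x = R$4$4 *\<^sub>R x + D *v x" for x
    by (simp add: D_def vec_eq_iff forall_4 matrix_vector_mult_def sum_4 assms(4-12))
       (simp add: algebra_simps)
  ultimately have ric: "ricci_operator (g49_bracket \<alpha>) g = (\<lambda>x. R$4$4 *\<^sub>R x + D *v x)"
    by auto
  with der have "algebraic_ricci_soliton (g49_bracket \<alpha>) g"
    unfolding algebraic_ricci_soliton_def by blast
  with der ric assms(13) show ?thesis
    unfolding D_def[symmetric] Let_def by simp
qed

end
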